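(* Let $v,\lambda,\mu>0$, $p\in(0,1]$, $D_a=\frac1\lambda$ and $\rho=\frac{p\lambda}{\mu}$, with $\rho<1$. For an agent following the random waypoint trajectory under D/M/1 queuing (waypoint intervals $Y_j=D_a$ deterministic, service times i.i.d. exponential with rate $\mu$, each waypoint update polled independently with probability $p$, first-come-first-served single server in steady state), the Age of Positioning is ${\rm AoP}=p\,\kappa\,\lambda\,\mathbb{E}[Q_i]$, where $$\mathbb{E}[Q_i] = \frac{v^2 D_a^3}{3p} + \frac{v^2 D_a^3 (1-p)}{p^2} + v^2 D_a^2\left[\frac{p\, e^{-\mu(1-\beta)D_a}}{\mu(1-\beta)\left\{1-(1-p)e^{-\mu(1-\beta)D_a}\right\}^2}+\frac{1}{\mu p}\right],$$ and $\beta\in(0,1)$ is the solution of $$\beta=\frac{p\, e^{-\mu(1-\beta)D_a}}{1-(1-p)e^{-\mu(1-\beta)D_a}}.$$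
   Context: An agent moves in the plane in successive hops with constant speed $v$; at the end of each hop (a waypoint) it picks a new direction uniformly in $(0,2\pi]$, independently. Waypoints are generated by an arrival process of rate $\lambda$. At each waypoint a position update is generated and, independently of everything else, is transmitted ("polled") with probability $p$ and otherwise discarded. Polled updates enter a single-server first-come-first-served queue with service rate $\mu$ and become available at the central server on departure. Service times are independent of the arrival and polling processes. In the notation A/B/1, A refers to the waypoint generation process before polling and B to the service process. Let $X_i$ be the time between the $(i-1)$-th and the $i$-th polled updates. Then $X_i=\sum_{j=1}^{k}Y_j$, where $Y_1,\dots,Y_k$ are the durations of the successive hops between these two polled updates and $k$ is the number of such hops, geometric with $\Pr(k=n)=p(1-p)^{n-1}$, $n\ge 1$. For D arrivals $Y_j=D_a=1/\lambda$ for all $j$. Let $S_i$ be the service time of the $i$-th polled update (for M service: exponential with rate $\mu$) and let $T_i=W_i+S_i$ be its total time in the system, with waiting time $W_i=(T_{i-1}-X_i)^+$. The queue is in steady state, so $T_{i-1}$ has the stationary system-time distribution and is independent of $X_i$. The position error bound of the position estimate computed from the last available update, after hops of durations $\delta_1,\dots,\delta_h$ since that update was generated, is ${\rm PEB}={\rm PEB}_{\rm o}+\kappa\sum_{l=1}^{h}v^2\delta_l^2$, where ${\rm PEB}_{\rm o}$ is the bound at the instant the update was generated; $\kappa=1$ in the motion agnostic mode and $\kappa=\epsilon^2/3$ in the dead-reckoning aided mode (direction sensor errors uniform on $(-\epsilon,\epsilon)$, $\epsilon$ small). The Age of Positioning (AoP) is the long-run time average of ${\rm PEB}(t)-{\rm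 PEB}_{\rm o}$; it is expressed as (and may be taken here to be defined by) $${\rm AoP}=p\,\kappa\,\lambda\,\mathbb{E}[Q_i],\qquad Q_i=G_1+G_2+G_3,$$ $$G_1=\sum_{j=1}^{k}\frac{v^2}{3}Y_j^3,\qquad G_2=\sum_{j=1}^{k}Y_j\Big(\sum_{l=1}^{j-1}v^2Y_l^2\Big),\qquad G_3=H_iT_i,\qquad H_i=\sum_{j=1}^{k}v^2Y_j^2 .$$ *)

theory Defs
  imports "HOL-Probability.Probability"
begin

text \<open>
  A cycle is the span between two consecutive polled updates: cycle \<open>i \<ge> 1\<close> runs from the
  \<open>(i-1)\<close>-th to the \<open>i\<close>-th one. It consists of \<open>k i\<close> hops, the \<open>j\<close>-th of which
  (\<open>1 \<le> j \<le> k i\<close>) lasts \<open>Y i j\<close>; \<open>S i\<close> and \<open>T i\<close> are the service time and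
  the total system time of the \<open>i\<close>-th polled update. Cycle index 0 is used by \<open>T\<close> only.
\<close>

definition interarrival ::
  "(nat \<Rightarrow> nat \<Rightarrow> 'a \<Rightarrow> real) \<Rightarrow> (nat \<Rightarrow> 'a \<Rightarrow> nat) \<Rightarrow> nat \<Rightarrow> 'a \<Rightarrow> real" where
  "interarrival Y k i \<omega> = (\<Sum>j=1..k i \<omega>. Y i j \<omega>)"

definition waiting_time ::
  "(nat \<Rightarrow> nat \<Rightarrow> 'a \<Rightarrow> real) \<Rightarrow> (nat \<Rightarrow> 'a \<Rightarrow> nat) \<Rightarrow> (nat \<Rightarrow> 'a \<Rightarrow> real) \<Rightarrow> nat \<Rightarrow> 'a \<Rightarrow> real" where
  "waiting_time Y k T i \<omega> = max 0 (T (i - 1) \<omega> - interarrival Y k i \<omega>)"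

datatype source = Initial | Hop nat nat | Count nat | Service nat

text \<open>
  The driving random variables as one real-valued family, so that their joint independence
  can be expressed by \<open>indep_vars\<close>.
\<close>

fun drive ::
  "(nat \<Rightarrow> nat \<Rightarrow> 'a \<Rightarrow> real) \<Rightarrow> (nat \<Rightarrow> 'a \<Rightarrow> nat) \<Rightarrow> (nat \<Rightarrow> 'a \<Rightarrow> real) \<Rightarrow> (nat \<Rightarrow> 'a \<Rightarrow> real) \<Rightarrow>
    source \<Rightarrow> 'a \<Rightarrow> real" where
  "drive Y k S T Initial = T 0"
| "drive Y k S T (Hop i j) = Y i j"
| "drive Y k S T (Count i) = (\<lambda>\<omega>. real (k i \<omega>))"
| "drive Y k S T (Service i) = S i"

definition sources :: "source set" where
  "sources = {Initial} \<union> {Hop i j | i j. 1 \<le> i \<and> 1 \<le> j}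
     \<union> {Count i | i. 1 \<le> i} \<union> {Service i | i. 1 \<le> i}"

locale polled_queue = prob_space M for M :: "'a measure" +
  fixes p :: real
    and Y :: "nat \<Rightarrow> nat \<Rightarrow> 'a \<Rightarrow> real"
    and k :: "nat \<Rightarrow> 'a \<Rightarrow> nat"
    and S :: "nat \<Rightarrow> 'a \<Rightarrow> real"
    and T :: "nat \<Rightarrow> 'a \<Rightarrow> real"
  assumes indep: "indep_vars (\<lambda>_. borel) (drive Y k S T) sources"
    and count_geometric:
      "\<And>i n. 1 \<le> i \<Longrightarrow> 1 \<le> n \<Longrightarrow> prob {\<omega> \<in> space M. k i \<omega> = n} = p * (1 - p) ^ (n - 1)"
    and system_time:
      "\<And>i \<omega>. 1 \<le> i \<Longrightarrow> \<omega> \<in> space M \<Longrightarrow> T i \<omega> = waiting_time Y k T i \<omega> + S i \<omega>"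
    and steady_state: "\<And>i. distr M borel (T i) = distr M borel (T 0)"

locale dm1_polled_queue = polled_queue +
  fixes lam mu :: real
  assumes deterministic_hops:
      "\<And>i j \<omega>. 1 \<le> i \<Longrightarrow> 1 \<le> j \<Longrightarrow> \<omega> \<in> space M \<Longrightarrow> Y i j \<omega> = 1 / lam"
    and exponential_service:
      "\<And>i. 1 \<le> i \<Longrightarrow> distributed M lborel (S i) (exponential_density mu)"

text \<open>
  The constructor argument is the half-width \<open>\<epsilon>\<close> of the uniform direction-sensor error.
\<close>

datatype mode = Motion_Agnostic | Dead_Reckoning real

fun kappa :: "mode \<Rightarrow> real" where
  "kappa Motion_Agnostic = 1"
| "kappa (Dead_Reckoning \<epsilon>) = \<epsilon>\<^sup>2 / 3"

definition H ::
  "real \<Rightarrow> (nat \<Rightarrow> nat \<Rightarrow> 'a \<Rightarrow> real) \<Rightarrow> (nat \<Rightarrow> 'a \<Rightarrow> nat) \<Rightarrow> nat \<Rightarrow> 'a \<Rightarrow> real" where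
  "H v Y k i \<omega> = (\<Sum>j=1..k i \<omega>. v\<^sup>2 * (Y i j \<omega>)\<^sup>2)"

definition G1 ::
  "real \<Rightarrow> (nat \<Rightarrow> nat \<Rightarrow> 'a \<Rightarrow> real) \<Rightarrow> (nat \<Rightarrow> 'a \<Rightarrow> nat) \<Rightarrow> nat \<Rightarrow> 'a \<Rightarrow> real" where
  "G1 v Y k i \<omega> = (\<Sum>j=1..k i \<omega>. v\<^sup>2 / 3 * Y i j \<omega> ^ 3)"

definition G2 ::
  "real \<Rightarrow> (nat \<Rightarrow> nat \<Rightarrow> 'a \<Rightarrow> real) \<Rightarrow> (nat \<Rightarrow> 'a \<Rightarrow> nat) \<Rightarrow> nat \<Rightarrow> 'a \<Rightarrow> real" where
  "G2 v Y k i \<omega> = (\<Sum>j=1..k i \<omega>. Y i j \<omega> * (\<Sum>l=1..<j. v\<^sup>2 * (Y i l \<omega>)\<^sup>2))"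

definition G3 ::
  "real \<Rightarrow> (nat \<Rightarrow> nat \<Rightarrow> 'a \<Rightarrow> real) \<Rightarrow> (nat \<Rightarrow> 'a \<Rightarrow> nat) \<Rightarrow> (nat \<Rightarrow> 'a \<Rightarrow> real) \<Rightarrow>
    nat \<Rightarrow> 'a \<Rightarrow> real" where
  "G3 v Y k T i \<omega> = H v Y k i \<omega> * T i \<omega>"

definition Q ::
  "real \<Rightarrow> (nat \<Rightarrow> nat \<Rightarrow> 'a \<Rightarrow> real) \<Rightarrow> (nat \<Rightarrow> 'a \<Rightarrow> nat) \<Rightarrow> (nat \<Rightarrow> 'a \<Rightarrow> real) \<Rightarrow>
    nat \<Rightarrow> 'a \<Rightarrow> real" where
  "Q v Y k T i \<omega> = G1 v Y k i \<omega> + G2 v Y k i \<omega> + G3 v Y k T i \<omega>"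

text \<open>
  The Age of Positioning is the long-run time average of the excess position error bound, taken
  here in its per-cycle form: \<open>p \<lambda>\<close> polled updates per unit of time, each contributing
  \<open>\<kappa> E[Q i]\<close>. In steady state the choice of the cycle \<open>i \<ge> 1\<close> is immaterial.
\<close>

definition AoP ::
  "'a measure \<Rightarrow> real \<Rightarrow> real \<Rightarrow> mode \<Rightarrow> real \<Rightarrow> (nat \<Rightarrow> nat \<Rightarrow> 'a \<Rightarrow> real) \<Rightarrow> (nat \<Rightarrow> 'a \<Rightarrow> nat) \<Rightarrow>
    (nat \<Rightarrow> 'a \<Rightarrow> real) \<Rightarrow> nat \<Rightarrow> real" where
  "AoP M p lam m v Y k T i = p * kappa m * lam * (\<integral>\<omega>. Q v Y k T i \<omega> \<partial>M)"

definition is_beta :: "real \<Rightarrow> real \<Rightarrow> real \<Rightarrow> real \<Rightarrow> bool" where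
  "is_beta p mu D \<beta> \<longleftrightarrow> 0 < \<beta> \<and> \<beta> < 1 \<and>
     \<beta> = p * exp (- mu * (1 - \<beta>) * D) / (1 - (1 - p) * exp (- mu * (1 - \<beta>) * D))"

end

theory Submission
  imports Defs "HOL-Real_Asymp.Real_Asymp"
begin

text \<open>
  The heart of the proof is that the stationary system time is exponential with rate
  \<open>\<theta> = \<mu> (1 - \<beta>)\<close>. The tail \<open>G t = P(T > t)\<close> of any stationary law satisfies
  \<open>G t = E[if S > t then 1 else a (t - S)]\<close> with \<open>a w = E[G (w + X)]\<close>, and so does
  \<open>exp (- \<theta> t)\<close>, because the equation for \<open>\<beta>\<close> says \<open>E[exp (- \<theta> X)] = \<beta> = 1 - \<theta> / \<mu>\<close>.
  If the difference \<open>d\<close> of two solutions is bounded by \<open>c\<close>, then conditioning on \<open>S\<close> bounds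
  \<open>\<bar>d t\<bar>\<close> by \<open>c (1 - exp (- \<mu> t))\<close>; as \<open>d\<close> also vanishes at infinity, its supremum is 0.
  Conditionally on \<open>k\<close>, the waiting time \<open>(T - k D)\<^sup>+\<close> then has mean
  \<open>exp (- \<theta> k D) / \<theta>\<close>, and \<open>E[Q]\<close> reduces to power series in \<open>1 - p\<close>.

  With \<open>x = \<mu> D (1 - \<beta>)\<close> the equation for \<open>\<beta>\<close> becomes
  \<open>(1 - p) x + p x / (1 - exp (- x)) = \<mu> D\<close>, whose left-hand side increases from \<open>p\<close> at
  \<open>0+\<close>; hence exactly one root when \<open>p < \<mu> D\<close>.
\<close>

section \<open>Conditioning on one of two independent random variables\<close>

text \<open>Independence makes the joint law the product of the two marginal laws, so this is
  Tonelli pulled back to \<open>M\<close>.\<close>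

lemma (in prob_space) indep_var_nn_integral_pair:
  assumes ind: "indep_var N1 X N2 Y"
    and f[measurable]: "f \<in> borel_measurable (N1 \<Otimes>\<^sub>M N2)"
  shows "(\<integral>\<^sup>+\<omega>. f (X \<omega>, Y \<omega>) \<partial>M) = (\<integral>\<^sup>+\<omega>'. (\<integral>\<^sup>+\<omega>. f (X \<omega>, Y \<omega>') \<partial>M) \<partial>M)"
proof -
  have [measurable]: "X \<in> measurable M N1" "Y \<in> measurable M N2"
    and eq: "distr M N1 X \<Otimes>\<^sub>M distr M N2 Y = distr M (N1 \<Otimes>\<^sub>M N2) (\<lambda>\<omega>. (X \<omega>, Y \<omega>))"
    using ind unfolding indep_var_distribution_eq by auto
  interpret X: prob_space "distr M N1 X" by (rule prob_space_distr) measurable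
  interpret Y: prob_space "distr M N2 Y" by (rule prob_space_distr) measurable
  interpret pair_sigma_finite "distr M N1 X" "distr M N2 Y" ..
  have "(\<integral>\<^sup>+\<omega>. f (X \<omega>, Y \<omega>) \<partial>M) = integral\<^sup>N (distr M (N1 \<Otimes>\<^sub>M N2) (\<lambda>\<omega>. (X \<omega>, Y \<omega>))) f"
    by (simp add: nn_integral_distr)
  also have "\<dots> = (\<integral>\<^sup>+y. (\<integral>\<^sup>+x. f (x, y) \<partial>distr M N1 X) \<partial>distr M N2 Y)"
    by (simp add: eq[symmetric] nn_integral_snd)
  also have "\<dots> = (\<integral>\<^sup>+\<omega>'. (\<integral>\<^sup>+\<omega>. f (X \<omega>, Y \<omega>') \<partial>M) \<partial>M)"
    by (simp add: nn_integral_distr cong: nn_integral_cong)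
  finally show ?thesis .
qed

text \<open>Tonelli for the indicator of the set \<open>?B\<close> where \<open>R\<close> holds:
  fixing the second argument turns the inner integral into a probability.\<close>

lemma (in prob_space) indep_var_prob_eq_expectation:
  assumes ind: "indep_var N1 X N2 Y"
    and R[measurable]: "{z \<in> space (N1 \<Otimes>\<^sub>M N2). R (fst z) (snd z)} \<in> sets (N1 \<Otimes>\<^sub>M N2)"
  shows "prob {\<omega> \<in> space M. R (X \<omega>) (Y \<omega>)} = expectation (\<lambda>\<omega>'. prob {\<omega> \<in> space M. R (X \<omega>) (Y \<omega>')})"
    and "(\<lambda>\<omega>'. prob {\<omega> \<in> space M. R (X \<omega>) (Y \<omega>')}) \<in> borel_measurable M"
proof -
  let ?B = "{z \<in> space (N1 \<Otimes>\<^sub>M N2). R (fst z) (snd z)}"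
  let ?f = "indicator ?B :: _ \<Rightarrow> ennreal"
  have [measurable]: "X \<in> measurable M N1" "Y \<in> measurable M N2"
    using ind unfolding indep_var_distribution_eq by auto
  have sp: "X \<omega> \<in> space N1" "Y \<omega> \<in> space N2" if "\<omega> \<in> space M" for \<omega>
    using that measurable_space[of X M N1] measurable_space[of Y M N2] by auto
  have inner: "(\<integral>\<^sup>+\<omega>. ?f (X \<omega>, y) \<partial>M) = ennreal (prob {\<omega> \<in> space M. R (X \<omega>) y})"
    if y: "y \<in> space N2" for y
  proof -
    have [measurable]: "(\<lambda>\<omega>. (X \<omega>, y)) \<in> measurable M (N1 \<Otimes>\<^sub>M N2)" using y by measurable
    have eq: "{\<omega> \<in> space M. R (X \<omega>) y} = (\<lambda>\<omega>. (X \<omega>, y)) -` ?B \<inter> space M"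
      using y sp by (auto simp: space_pair_measure)
    have "{\<omega> \<in> space M. R (X \<omega>) y} \<in> events" unfolding eq by measurable
    moreover have "(\<integral>\<^sup>+\<omega>. ?f (X \<omega>, y) \<partial>M) = (\<integral>\<^sup>+\<omega>. indicator {\<omega> \<in> space M. R (X \<omega>) y} \<omega> \<partial>M)"
      using y sp by (intro nn_integral_cong) (auto simp: indicator_def space_pair_measure)
    ultimately show ?thesis by (simp add: emeasure_eq_measure)
  qed
  \<comment> \<open>Partial integrals of the indicator of \<open>?B\<close> are measurable;
    \<open>enn2real\<close> carries this over to the real-valued probability.\<close>
  have "(\<lambda>\<omega>'. enn2real (\<integral>\<^sup>+\<omega>. ?f (X \<omega>, Y \<omega>') \<partial>M)) \<in> borel_measurable M" by measurable
  also have "?this \<longleftrightarrow> (\<lambda>\<omega>'. prob {\<omega> \<in> space M. R (X \<omega>) (Y \<omega>')}) \<in> borel_measurable M"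
    by (intro measurable_cong) (simp add: inner sp)
  finally show m: "(\<lambda>\<omega>'. prob {\<omega> \<in> space M. R (X \<omega>) (Y \<omega>')}) \<in> borel_measurable M" .
  have ev: "{\<omega> \<in> space M. R (X \<omega>) (Y \<omega>)} \<in> events"
  proof -
    have eq: "{\<omega> \<in> space M. R (X \<omega>) (Y \<omega>)} = (\<lambda>\<omega>. (X \<omega>, Y \<omega>)) -` ?B \<inter> space M"
      using sp by (auto simp: space_pair_measure)
    show ?thesis unfolding eq by measurable
  qed
  have int: "integrable M (\<lambda>\<omega>'. prob {\<omega> \<in> space M. R (X \<omega>) (Y \<omega>')})"
    by (rule integrable_const_bound[where B=1]) (auto simp: m)
  have "ennreal (prob {\<omega> \<in> space M. R (X \<omega>) (Y \<omega>)}) = (\<integral>\<^sup>+\<omega>. ?f (X \<omega>, Y \<omega>) \<partial>M)"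
  proof -
    have "(\<integral>\<^sup>+\<omega>. ?f (X \<omega>, Y \<omega>) \<partial>M) = (\<integral>\<^sup>+\<omega>. indicator {\<omega> \<in> space M. R (X \<omega>) (Y \<omega>)} \<omega> \<partial>M)"
      using sp by (intro nn_integral_cong) (auto simp: indicator_def space_pair_measure)
    then show ?thesis using ev by (simp add: emeasure_eq_measure)
  qed
  also have "\<dots> = (\<integral>\<^sup>+\<omega>'. ennreal (prob {\<omega> \<in> space M. R (X \<omega>) (Y \<omega>')}) \<partial>M)"
    by (subst indep_var_nn_integral_pair[OF ind]) (auto intro!: nn_integral_cong simp: inner sp)
  also have "\<dots> = ennreal (expectation (\<lambda>\<omega>'. prob {\<omega> \<in> space M. R (X \<omega>) (Y \<omega>')}))"
    by (rule nn_integral_eq_integral[OF int]) auto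
  finally show "prob {\<omega> \<in> space M. R (X \<omega>) (Y \<omega>)} = expectation (\<lambda>\<omega>'. prob {\<omega> \<in> space M. R (X \<omega>) (Y \<omega>')})"
    by (simp add: integral_nonneg_AE)
qed

section \<open>Stationary system time under exponential service\<close>

lemma (in prob_space) prob_greater_tendsto_0:
  assumes [measurable]: "random_variable borel T"
  shows "((\<lambda>t::real. prob {\<omega> \<in> space M. t < T \<omega>}) \<longlongrightarrow> 0) at_top"
proof -
  interpret D: real_distribution "distr M borel T" by (rule real_distribution_distr) simp
  have "prob {\<omega> \<in> space M. t < T \<omega>} = 1 - cdf (distr M borel T) t" for t
  proof -
    have "cdf (distr M borel T) t = prob {\<omega> \<in> space M. T \<omega> \<le> t}"
      by (simp add: cdf_def measure_distr vimage_def Int_def conj_commute)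
    also have "prob {\<omega> \<in> space M. T \<omega> \<le> t} = 1 - prob {\<omega> \<in> space M. \<not> T \<omega> \<le> t}"
      by (subst prob_neg) auto
    finally show ?thesis by (simp add: not_le)
  qed
  moreover have "((\<lambda>t. 1 - cdf (distr M borel T) t) \<longlongrightarrow> 1 - 1) at_top"
    by (intro tendsto_intros D.cdf_lim_at_top_prob)
  ultimately show ?thesis by simp
qed

text \<open>Makes the exponential tail of rate \<open>th\<close> a fixed point of the tail equation.
  Service times beyond \<open>t\<close> contribute \<open>exp (- mu * t)\<close>, those up to
  \<open>t\<close> contribute \<open>exp (- th * t) - exp (- mu * t)\<close>.\<close>

lemma (in prob_space) expectation_exponential_tail_eq:
  fixes S :: "'a \<Rightarrow> real"
  assumes S: "distributed M lborel S (exponential_density mu)"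
    and "0 < th" "th < mu" "0 \<le> t"
  shows "expectation (\<lambda>\<omega>. if t < S \<omega> then 1 else (1 - th / mu) * exp (- th * (t - S \<omega>))) = exp (- th * t)"
    (is "expectation (\<lambda>\<omega>. ?f (S \<omega>)) = _")
    and "integrable M (\<lambda>\<omega>. if t < S \<omega> then 1 else (1 - th / mu) * exp (- th * (t - S \<omega>)))"
proof -
  have mu: "0 < mu" using assms by linarith
  have [measurable]: "S \<in> borel_measurable M" using distributed_measurable[OF S] by simp
  \<comment> \<open>\<open>g\<close> is the density times the second branch of the integrand, by
    \<open>mu * (1 - th / mu) = mu - th\<close>; \<open>F\<close> is its antiderivative.\<close>
  define F where "F s = exp (- th * t) * (- exp (- (mu - th) * s))" for s
  define g where "g s = (mu - th) * (exp (- th * t) * exp (- (mu - th) * s))" for s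
  have dF: "DERIV F s :> g s" for s
    unfolding F_def g_def
    by (auto intro!: derivative_eq_intros simp: algebra_simps)
  have hb: "has_bochner_integral lborel (\<lambda>s. g s * indicator {0..t} s) (F t - F 0)"
  proof (rule has_bochner_integral_FTC_Icc_real)
    show "isCont g s" for s unfolding g_def by (intro continuous_intros)
  qed (use assms dF in auto)
  have hS: "has_bochner_integral lborel (\<lambda>s. exponential_density mu s * indicator {t<..} s) (exp (- t * mu))"
  proof -
    have "integrable M (\<lambda>\<omega>. indicator {t<..} (S \<omega>) :: real)"
      by (rule integrable_const_bound[where B=1]) auto
    then have "integrable lborel (\<lambda>s. exponential_density mu s * indicator {t<..} s)"
      by (subst distributed_integrable[OF S]) (auto simp: exponential_density_nonneg mu)
    moreover have "(\<integral>s. exponential_density mu s * indicator {t<..} s \<partial>lborel) = (\<integral>\<omega>. indicator {t<..} (S \<omega>) \<partial>M)"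
      by (subst distributed_integral[OF S]) (auto simp: exponential_density_nonneg mu)
    moreover have "(\<integral>\<omega>. indicator {t<..} (S \<omega>) \<partial>M) = prob {\<omega> \<in> space M. t < S \<omega>}"
    proof -
      have "(\<integral>\<omega>. indicator {t<..} (S \<omega>) \<partial>M) = (\<integral>\<omega>. indicator {\<omega> \<in> space M. t < S \<omega>} \<omega> \<partial>M :: real)"
        by (intro Bochner_Integration.integral_cong) (auto simp: indicator_def)
      then show ?thesis by simp
    qed
    ultimately show ?thesis
      using exponential_distributedD_gt[OF S \<open>0 \<le> t\<close> mu] by (simp add: has_bochner_integral_iff)
  qed
  \<comment> \<open>Since \<open>0 \<le> t\<close>, the two indicators split the half-line on which
    the density is nonzero.\<close>
  have eq: "exponential_density mu s * ?f s =
      exponential_density mu s * indicator {t<..} s + g s * indicator {0..t} s" for s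
  proof -
    have "mu * exp (- s * mu) * ((1 - th / mu) * exp (- th * (t - s))) = g s"
    proof -
      have "exp (- s * mu) * exp (- th * (t - s)) = exp (- th * t) * exp (- (mu - th) * s)"
        unfolding mult_exp_exp by (rule arg_cong[where f=exp]) algebra
      moreover have "mu * (1 - th / mu) = mu - th" using mu by (simp add: field_simps)
      ultimately show ?thesis unfolding g_def by (metis mult.assoc mult.left_commute)
    qed
    then show ?thesis
      using assms by (auto simp: exponential_density_def indicator_def)
  qed
  have "has_bochner_integral lborel (\<lambda>s. exponential_density mu s * ?f s) (exp (- t * mu) + (F t - F 0))"
    unfolding eq by (rule has_bochner_integral_add[OF hS hb])
  moreover have "exp (- t * mu) + (F t - F 0) = exp (- th * t)"
  proof -
    have "F t = - exp (- t * mu)"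
      unfolding F_def mult_minus_right mult_exp_exp by (simp add: algebra_simps)
    moreover have "F 0 = - exp (- th * t)" by (simp add: F_def)
    ultimately show ?thesis by simp
  qed
  ultimately have "has_bochner_integral lborel (\<lambda>s. exponential_density mu s * ?f s) (exp (- th * t))"
    by simp
  then show "expectation (\<lambda>\<omega>. ?f (S \<omega>)) = exp (- th * t)" "integrable M (\<lambda>\<omega>. ?f (S \<omega>))"
    using distributed_integral[OF S, of ?f] distributed_integrable[OF S, of ?f]
      exponential_density_nonneg[OF mu]
    by (simp_all add: has_bochner_integral_iff)
qed

text \<open>The factor \<open>1 - exp (- mu * t)\<close> stays away from 1 only on bounded ranges of
  \<open>t\<close>; the limit at infinity takes care of the rest. Together they would strictly
  improve a positive supremum.\<close>

lemma eq_0_if_exponential_contraction: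
  fixes d :: "real \<Rightarrow> real"
  assumes bdd: "\<And>t. 0 \<le> t \<Longrightarrow> \<bar>d t\<bar> \<le> B"
    and lim: "(d \<longlongrightarrow> 0) at_top" and mu: "0 < mu"
    and contr: "\<And>c t. (\<And>s. 0 \<le> s \<Longrightarrow> \<bar>d s\<bar> \<le> c) \<Longrightarrow> 0 \<le> t \<Longrightarrow> \<bar>d t\<bar> \<le> c * (1 - exp (- mu * t))"
    and t: "0 \<le> t"
  shows "d t = 0"
proof -
  define c where "c = (SUP s\<in>{0..}. \<bar>d s\<bar>)"
  have "bdd_above ((\<lambda>s. \<bar>d s\<bar>) ` {0..})" using bdd by (auto intro!: bdd_aboveI[where M=B])
  from cSUP_upper[OF _ this] have le: "\<bar>d s\<bar> \<le> c" if "0 \<le> s" for s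
    using that by (simp add: c_def)
  have "c \<le> 0"
  proof (rule ccontr)
    assume "\<not> c \<le> 0"
    then have c: "0 < c" by simp
    then have "eventually (\<lambda>s. \<bar>d s\<bar> < c / 2) at_top"
      using lim by (auto simp: tendsto_iff dist_real_def dest!: spec[of _ "c / 2"])
    then obtain A where A: "\<And>s. A \<le> s \<Longrightarrow> \<bar>d s\<bar> < c / 2"
      by (auto simp: eventually_at_top_linorder)
    \<comment> \<open>The first entry bounds \<open>d\<close> from \<open>A\<close> on, the second
      before \<open>A\<close>, where the contraction factor is at most its value at
      \<open>max 0 A\<close>. Both are below \<open>c\<close>.\<close>
    define q where "q = max (c / 2) (c * (1 - exp (- mu * max 0 A)))"
    have "\<bar>d s\<bar> \<le> q" if "0 \<le> s" for s
    proof (cases "A \<le> s")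
      case True
      then show ?thesis using A[of s] by (simp add: q_def)
    next
      case False
      have "\<bar>d s\<bar> \<le> c * (1 - exp (- mu * s))" by (rule contr[OF le that])
      also have "\<dots> \<le> c * (1 - exp (- mu * max 0 A))"
      proof -
        have "mu * s \<le> mu * max 0 A" using False mu by (intro mult_left_mono) auto
        then show ?thesis using c by (intro mult_left_mono diff_left_mono) simp_all
      qed
      finally show ?thesis by (simp add: q_def)
    qed
    then have "c \<le> q" unfolding c_def by (intro cSUP_least) auto
    moreover have "q < c" using c by (simp add: q_def)
    ultimately show False by simp
  qed
  then show ?thesis using le[OF t] by simp
qed

text \<open>The interarrival time \<open>X\<close> is general and influences the law only through
  its Laplace transform at \<open>th\<close>. The true tail \<open>G\<close> and the exponential
  tail solve the same equation, and contraction forces their difference \<open>d\<close> to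
  vanish.\<close>

lemma (in prob_space) gm1_system_time_exponential:
  fixes T X S :: "'a \<Rightarrow> real"
  assumes indTX: "indep_var borel T borel X"
    and indWS: "indep_var borel (\<lambda>\<omega>. max 0 (T \<omega> - X \<omega>)) borel S"
    and X_nonneg: "\<And>\<omega>. \<omega> \<in> space M \<Longrightarrow> 0 \<le> X \<omega>"
    and S: "distributed M lborel S (exponential_density mu)"
    and th: "0 < th" "th < mu"
    and lundberg: "expectation (\<lambda>\<omega>. exp (- th * X \<omega>)) = 1 - th / mu"
    and stationary: "distr M borel (\<lambda>\<omega>. max 0 (T \<omega> - X \<omega>) + S \<omega>) = distr M borel T"
  shows "distributed M lborel T (exponential_density th)"
proof -
  let ?W = "\<lambda>\<omega>. max 0 (T \<omega> - X \<omega>)"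
  have [measurable]: "T \<in> borel_measurable M" "X \<in> borel_measurable M" "S \<in> borel_measurable M"
    using indep_var_rv1[OF indTX] indep_var_rv2[OF indTX] indep_var_rv2[OF indWS] by simp_all
  have mu: "0 < mu" using th by linarith
  define G where "G t = prob {\<omega> \<in> space M. t < T \<omega>}" for t
  define a where "a w = prob {\<omega> \<in> space M. w < ?W \<omega>}" for w
  define d where "d t = G t - exp (- th * t)" for t
  have [measurable]: "G \<in> borel_measurable borel"
  proof -
    \<comment> \<open>\<open>G\<close> is antitone, so its negative is monotone and hence
      Borel.\<close>
    have "(\<lambda>t. - G t) \<in> borel_measurable borel"
      by (intro borel_measurable_mono monoI) (auto simp: G_def intro!: finite_measure_mono)
    then show ?thesis by simp
  qed
  have G01: "0 \<le> G t" "G t \<le> 1" for t by (auto simp: G_def)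
  have a01: "0 \<le> a t" "a t \<le> 1" for t by (auto simp: a_def)
  have a_neg: "a w = 1" if "w < 0" for w
  proof -
    have "{\<omega> \<in> space M. w < ?W \<omega>} = space M" using that by auto
    then show ?thesis by (simp add: a_def prob_space)
  qed
  have a_pos: "a w = expectation (\<lambda>\<omega>. G (w + X \<omega>))" if "0 \<le> w" for w
  proof -
    \<comment> \<open>For \<open>w \<ge> 0\<close> the truncation at 0 is invisible: the waiting
      time exceeds \<open>w\<close> exactly when \<open>T\<close> exceeds
      \<open>w + X\<close>.\<close>
    have "a w = prob {\<omega> \<in> space M. w + X \<omega> < T \<omega>}"
      unfolding a_def using that by (intro arg_cong[where f=prob]) auto
    also have "\<dots> = expectation (\<lambda>\<omega>. G (w + X \<omega>))"
      unfolding G_def by (rule indep_var_prob_eq_expectation(1)[OF indTX]) measurable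
    finally show ?thesis .
  qed
  have G_eq: "G t = expectation (\<lambda>\<omega>. a (t - S \<omega>))"
    and [measurable]: "(\<lambda>\<omega>. a (t - S \<omega>)) \<in> borel_measurable M" for t
  proof -
    have *: "prob {\<omega> \<in> space M. t - S \<omega> < ?W \<omega>} = expectation (\<lambda>\<omega>. a (t - S \<omega>))"
      unfolding a_def by (rule indep_var_prob_eq_expectation(1)[OF indWS]) measurable
    show "(\<lambda>\<omega>. a (t - S \<omega>)) \<in> borel_measurable M"
      unfolding a_def by (rule indep_var_prob_eq_expectation(2)[OF indWS]) measurable
    \<comment> \<open>Stationarity enters here: \<open>T\<close> is replaced by waiting plus service
      time of the next update.\<close>
    have "G t = measure (distr M borel T) {t<..}"
      by (simp add: G_def measure_distr vimage_def Int_def conj_commute)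
    also have "\<dots> = prob {\<omega> \<in> space M. t < ?W \<omega> + S \<omega>}"
      by (simp add: stationary[symmetric] measure_distr vimage_def Int_def conj_commute)
    also have "\<dots> = prob {\<omega> \<in> space M. t - S \<omega> < ?W \<omega>}"
      by (intro arg_cong[where f=prob]) auto
    finally show "G t = expectation (\<lambda>\<omega>. a (t - S \<omega>))" using * by simp
  qed
  have int_exp: "integrable M (\<lambda>\<omega>. exp (- th * (w + X \<omega>)))" if "0 \<le> w" for w
  proof (rule integrable_const_bound[where B=1])
    show "AE \<omega> in M. norm (exp (- th * (w + X \<omega>))) \<le> 1"
      using th that X_nonneg by (intro AE_I2) simp
  qed measurable
  have int_G: "integrable M (\<lambda>\<omega>. G (w + X \<omega>))" for w
    by (rule integrable_const_bound[where B=1]) (use G01 in auto)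
  have exp_shift: "expectation (\<lambda>\<omega>. exp (- th * (w + X \<omega>))) = (1 - th / mu) * exp (- th * w)" for w
  proof -
    have "exp (- th * (w + x)) = exp (- th * w) * exp (- th * x)" for x
      by (simp only: distrib_left exp_add)
    then show ?thesis using lundberg by (simp only: integral_mult_right_zero mult.commute)
  qed
  have contr: "\<bar>d t\<bar> \<le> c * (1 - exp (- mu * t))"
    if le: "\<And>s. 0 \<le> s \<Longrightarrow> \<bar>d s\<bar> \<le> c" and t: "0 \<le> t" for c t
  proof -
    have a_diff: "\<bar>a w - (1 - th / mu) * exp (- th * w)\<bar> \<le> c" if w: "0 \<le> w" for w
    proof -
      \<comment> \<open>By \<open>lundberg\<close> the exponential counterpart of \<open>a\<close>
        is also an average over \<open>X\<close>, so the error in \<open>a\<close> is an average of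
        errors in \<open>G\<close> at points \<open>w + X \<ge> 0\<close>.\<close>
      have a_eq: "a w - (1 - th / mu) * exp (- th * w) = expectation (\<lambda>\<omega>. d (w + X \<omega>))"
        unfolding d_def by (subst Bochner_Integration.integral_diff[OF int_G int_exp[OF w]])
          (simp only: a_pos[OF w] exp_shift)
      have "\<bar>a w - (1 - th / mu) * exp (- th * w)\<bar> \<le> expectation (\<lambda>\<omega>. \<bar>d (w + X \<omega>)\<bar>)"
        unfolding a_eq by (rule integral_abs_bound)
      also have "\<dots> \<le> expectation (\<lambda>\<omega>. c)"
      proof (rule integral_mono)
        show "integrable M (\<lambda>\<omega>. \<bar>d (w + X \<omega>)\<bar>)"
          unfolding d_def by (intro integrable_abs Bochner_Integration.integrable_diff int_G int_exp w)
      qed (use w X_nonneg in \<open>auto intro!: le\<close>)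
      finally show ?thesis by (simp add: prob_space)
    qed
    let ?h = "\<lambda>\<omega>. if t < S \<omega> then 1 else (1 - th / mu) * exp (- th * (t - S \<omega>))"
    have int_a: "integrable M (\<lambda>\<omega>. a (t - S \<omega>))"
      by (rule integrable_const_bound[where B=1]) (use a01 in auto)
    note int_h = expectation_exponential_tail_eq(2)[OF S th t]
    have "d t = expectation (\<lambda>\<omega>. a (t - S \<omega>)) - expectation ?h"
      unfolding d_def G_eq[of t] expectation_exponential_tail_eq(1)[OF S th t] ..
    also have "\<dots> = expectation (\<lambda>\<omega>. a (t - S \<omega>) - ?h \<omega>)"
      by (rule Bochner_Integration.integral_diff[OF int_a int_h, symmetric])
    finally have d_eq: "d t = expectation (\<lambda>\<omega>. a (t - S \<omega>) - ?h \<omega>)" .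
    have "\<bar>d t\<bar> \<le> expectation (\<lambda>\<omega>. \<bar>a (t - S \<omega>) - ?h \<omega>\<bar>)"
      unfolding d_eq by (rule integral_abs_bound)
    also have "\<dots> \<le> expectation (\<lambda>\<omega>. c * indicator {\<omega> \<in> space M. S \<omega> \<le> t} \<omega>)"
    proof (rule integral_mono)
      show "integrable M (\<lambda>\<omega>. \<bar>a (t - S \<omega>) - ?h \<omega>\<bar>)"
        by (rule integrable_abs[OF Bochner_Integration.integrable_diff[OF int_a int_h]])
      show "integrable M (\<lambda>\<omega>. c * indicator {\<omega> \<in> space M. S \<omega> \<le> t} \<omega>)"
        by (intro integrable_mult_right integrable_real_indicator) (auto simp: emeasure_eq_measure)
      \<comment> \<open>If \<open>t < S\<close> both terms are 1 and cancel. Only the event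
        \<open>S \<le> t\<close>, of probability \<open>1 - exp (- mu * t)\<close>, is left; this is
        the contraction factor.\<close>
      show "\<bar>a (t - S \<omega>) - ?h \<omega>\<bar> \<le> c * indicator {\<omega> \<in> space M. S \<omega> \<le> t} \<omega>"
        if "\<omega> \<in> space M" for \<omega>
        using that a_diff[of "t - S \<omega>"] a_neg[of "t - S \<omega>"] by (auto simp: not_less)
    qed
    also have "\<dots> = c * (1 - exp (- mu * t))"
      using exponential_distributedD_le[OF S t mu] by (simp add: mult.commute)
    finally show ?thesis .
  qed
  have lim: "(d \<longlongrightarrow> 0 - 0) at_top"
    unfolding d_def G_def
  proof (rule tendsto_diff[OF prob_greater_tendsto_0])
    have "filterlim (\<lambda>t. th * t) at_top at_top"
      using th by (intro filterlim_tendsto_pos_mult_at_top[OF tendsto_const _ filterlim_ident])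
    then show "((\<lambda>t. exp (- th * t)) \<longlongrightarrow> 0) at_top"
      by (simp add: filterlim_compose[OF exp_at_bot] filterlim_uminus_at_bot)
  qed simp
  have bdd: "\<bar>d t\<bar> \<le> 2" if "0 \<le> t" for t
  proof -
    have "exp (- th * t) \<le> 1" "0 < exp (- th * t)" using th that by auto
    then show ?thesis using G01[of t] unfolding d_def by linarith
  qed
  have d0: "d t = 0" if "0 \<le> t" for t
  proof (rule eq_0_if_exponential_contraction[OF bdd _ mu _ that])
    show "(d \<longlongrightarrow> 0) at_top" using lim by simp
  qed (assumption, rule contr)
  have "prob {\<omega> \<in> space M. T \<omega> \<le> t} = 1 - exp (- t * th)" if "0 \<le> t" for t
  proof -
    have "prob {\<omega> \<in> space M. T \<omega> \<le> t} = 1 - prob {\<omega> \<in> space M. \<not> T \<omega> \<le> t}"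
      by (subst prob_neg) auto
    then show ?thesis using d0[OF that] by (simp add: d_def G_def not_le mult.commute)
  qed
  then show ?thesis by (simp add: exponential_distributed_iff[OF th(1)])
qed

text \<open>Memorylessness: \<open>T\<close> passes \<open>c\<close> with probability
  \<open>exp (- th * c)\<close>, and the excess is then exponential again, with mean
  \<open>1 / th\<close>.\<close>

lemma (in prob_space) exponential_distributed_nn_integral_excess:
  assumes T: "distributed M lborel T (exponential_density th)" and th: "0 < th" and c: "0 \<le> c"
  shows "(\<integral>\<^sup>+\<omega>. ennreal (max 0 (T \<omega> - c)) \<partial>M) = ennreal (exp (- th * c) / th)"
proof -
  \<comment> \<open>An antiderivative of \<open>th * (x - c) * exp (- th * x)\<close> that vanishes
    at infinity.\<close>
  define F where "F x = - ((x - c + 1 / th) * exp (- th * x))" for x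
  have "(\<integral>\<^sup>+\<omega>. ennreal (max 0 (T \<omega> - c)) \<partial>M) =
      (\<integral>\<^sup>+x. ennreal (exponential_density th x) * ennreal (max 0 (x - c)) \<partial>lborel)"
    by (rule distributed_nn_integral[OF T, symmetric]) simp
  also have "\<dots> = (\<integral>\<^sup>+x. ennreal (th * (x - c) * exp (- th * x)) * indicator {c..} x \<partial>lborel)"
    using c th by (intro nn_integral_cong)
      (auto simp: exponential_density_def indicator_def ennreal_mult[symmetric] max_def mult_ac)
  also have "\<dots> = 0 - F c"
  proof (rule nn_integral_FTC_atLeast)
    show "(F has_real_derivative th * (x - c) * exp (- th * x)) (at x)" for x
      unfolding F_def by (rule derivative_eq_intros refl)+ (use th in \<open>auto simp: algebra_simps\<close>)
    have "(F \<longlongrightarrow> 0) at_top" unfolding F_def using th by real_asymp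
    then show "(F \<longlongrightarrow> 0) at_top" .
  qed (use th c in auto)
  also have "0 - F c = exp (- th * c) / th" by (simp add: F_def)
  finally show ?thesis by simp
qed

section \<open>A power series with triangular coefficients\<close>

text \<open>The Cauchy product of the series for \<open>1 / (1 - x)\<^sup>2\<close> and
  \<open>1 / (1 - x)\<close> has the triangular numbers as coefficients. Needed for the mean of
  \<open>k * (k - 1) / 2\<close>.\<close>

lemma triangular_power_sums:
  fixes x :: real
  assumes x: "norm x < 1"
  shows "(\<lambda>m. real (Suc m * m) / 2 * x ^ m) sums (x / (1 - x) ^ 3)"
proof -
  have ab: "summable (\<lambda>m. norm (x ^ m))" "summable (\<lambda>m. norm (real (Suc m) * x ^ m))"
    using summable_geometric[of "norm x"] sums_summable[OF geometric_deriv_sums[of "norm x"]] x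
    unfolding norm_power norm_mult norm_of_nat by simp_all
  have gsum: "(\<Sum>i\<le>m. real (Suc i)) = real (Suc (Suc m) * Suc m) / 2" for m
    by (induction m) (auto simp: field_simps)
  have "(\<lambda>m. \<Sum>i\<le>m. (real (Suc i) * x ^ i) * x ^ (m - i)) sums
      ((\<Sum>m. real (Suc m) * x ^ m) * (\<Sum>m. x ^ m))"
    by (rule Cauchy_product_sums[OF ab(2,1)])
  also have "(\<Sum>m. real (Suc m) * x ^ m) * (\<Sum>m. x ^ m) = 1 / (1 - x) ^ 3"
    using geometric_deriv_sums[OF x] suminf_geometric[OF x]
    by (simp add: sums_iff power3_eq_cube power2_eq_square)
  also have "(\<lambda>m. \<Sum>i\<le>m. (real (Suc i) * x ^ i) * x ^ (m - i)) =
      (\<lambda>m. real (Suc (Suc m) * Suc m) / 2 * x ^ m)"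
  proof
    fix m
    have "(\<Sum>i\<le>m. (real (Suc i) * x ^ i) * x ^ (m - i)) = (\<Sum>i\<le>m. real (Suc i) * x ^ m)"
      by (intro sum.cong) (auto simp: power_add[symmetric] mult.assoc)
    then show "(\<Sum>i\<le>m. (real (Suc i) * x ^ i) * x ^ (m - i)) = real (Suc (Suc m) * Suc m) / 2 * x ^ m"
      by (simp only: sum_distrib_right[symmetric] gsum)
  qed
  finally have "(\<lambda>m. x * (real (Suc (Suc m) * Suc m) / 2 * x ^ m)) sums (x * (1 / (1 - x) ^ 3))"
    by (rule sums_mult)
  then have "(\<lambda>m. real (Suc (Suc m) * Suc m) / 2 * x ^ Suc m) sums (x / (1 - x) ^ 3)"
    by (simp add: mult_ac)
  \<comment> \<open>The summand at \<open>m = 0\<close> is 0, so the index shift adds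
    nothing.\<close>
  then show ?thesis by (subst (asm) sums_Suc_iff) simp
qed

section \<open>Existence and uniqueness of \<beta>\<close>

text \<open>The numerator of the derivative, \<open>1 - exp (- u) - u * exp (- u)\<close>, is
  positive because \<open>1 + u < exp u\<close>.\<close>

lemma x_div_1_minus_exp_neg_strict_mono:
  fixes x y :: real
  assumes "0 < x" "x < y"
  shows "x / (1 - exp (- x)) < y / (1 - exp (- y))"
proof (rule DERIV_pos_imp_increasing[OF assms(2), of "\<lambda>x. x / (1 - exp (- x))"])
  fix u assume "x \<le> u" "u \<le> y"
  then have u: "0 < u" using assms by simp
  then have e: "exp (- u) < 1" by simp
  have "1 + u < exp u" using exp_minus_greater[of "- u"] u by simp
  then have "(1 + u) * exp (- u) < exp u * exp (- u)" by (intro mult_strict_right_mono) auto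
  then have num: "0 < 1 - exp (- u) - u * exp (- u)" by (simp add: exp_minus_inverse algebra_simps)
  have "((\<lambda>x. x / (1 - exp (- x))) has_real_derivative
      (1 - exp (- u) - u * exp (- u)) / (1 - exp (- u))\<^sup>2) (at u)"
  proof -
    have "((\<lambda>x. 1 - exp (- x)) has_real_derivative exp (- u)) (at u)"
      by (auto intro!: derivative_eq_intros)
    from DERIV_divide[OF DERIV_ident this] show ?thesis using e by (simp add: power2_eq_square)
  qed
  moreover have "0 < (1 - exp (- u) - u * exp (- u)) / (1 - exp (- u))\<^sup>2"
    using num e by (intro divide_pos_pos) auto
  ultimately show "\<exists>z. ((\<lambda>x. x / (1 - exp (- x))) has_real_derivative z) (at u) \<and> 0 < z" by blast
qed

text \<open>In the variable \<open>x = c * (1 - \<beta>)\<close>, which runs through the interval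
  from 0 to \<open>c\<close>, uniqueness is monotonicity of \<open>h\<close> and existence is the
  intermediate value theorem. Stability places the start \<open>p\<close> of \<open>h\<close> below
  the level \<open>c\<close>.\<close>

lemma ex1_is_beta:
  assumes mu: "0 < mu" and D: "0 < D" and p: "0 < p" "p \<le> 1" and stable: "p < mu * D"
  shows "\<exists>!\<beta>. is_beta p mu D \<beta>"
proof -
  define c where "c = mu * D"
  have c: "0 < c" "p < c" using mu D stable by (auto simp: c_def)
  define h where "h x = (1 - p) * x + p * (x / (1 - exp (- x)))" for x :: real
  have beta_iff: "is_beta p mu D \<beta> \<longleftrightarrow> 0 < \<beta> \<and> \<beta> < 1 \<and> h (c * (1 - \<beta>)) = c" for \<beta>
  proof (cases "0 < \<beta> \<and> \<beta> < 1")
    case True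
    define x where "x = c * (1 - \<beta>)"
    define z where "z = exp (- x)"
    have x: "0 < x" using True c by (simp add: x_def)
    have z: "0 < z" "z < 1" using x by (auto simp: z_def)
    have "(1 - p) * z < 1" using z p by (smt (verit) mult_left_le_one_le)
    have "\<beta> = p * z / (1 - (1 - p) * z) \<longleftrightarrow> \<beta> * (1 - (1 - p) * z) = p * z"
      using \<open>(1 - p) * z < 1\<close> by (simp add: field_simps)
    also have "\<dots> \<longleftrightarrow> c * (\<beta> * (1 - (1 - p) * z)) = c * (p * z)" using c by simp
    \<comment> \<open>Uses \<open>c * \<beta> = c - x\<close>. The next step divides by
      \<open>1 - z\<close>, which removes the trivial root \<beta> = 1.\<close>
    also have "\<dots> \<longleftrightarrow> (1 - p) * x * (1 - z) + p * x = c * (1 - z)"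
      unfolding x_def by (auto simp: algebra_simps)
    also have "\<dots> \<longleftrightarrow> h x = c" using z by (simp add: h_def z_def[symmetric] field_simps)
    finally have "\<beta> = p * z / (1 - (1 - p) * z) \<longleftrightarrow> h x = c" .
    moreover have "z = exp (- mu * (1 - \<beta>) * D)" by (simp add: z_def x_def c_def mult_ac)
    ultimately show ?thesis using True by (simp add: is_beta_def x_def)
  next
    case False
    then show ?thesis by (auto simp: is_beta_def)
  qed
  have h_mono: "h x < h y" if "0 < x" "x < y" for x y
    unfolding h_def using x_div_1_minus_exp_neg_strict_mono[OF that] p that
    by (intro add_le_less_mono mult_left_mono mult_strict_left_mono) auto
  have h_le: "h x \<le> x + p" if x: "0 < x" for x
  proof -
    have "(1 + x) * exp (- x) \<le> exp x * exp (- x)" by (intro mult_right_mono) auto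
    then have "x \<le> (1 + x) * (1 - exp (- x))" by (simp add: exp_minus_inverse algebra_simps)
    then have "x / (1 - exp (- x)) \<le> 1 + x" using x by (simp add: divide_le_eq)
    then have "p * (x / (1 - exp (- x))) \<le> p * (1 + x)" using p by (intro mult_left_mono) auto
    then show ?thesis by (simp add: h_def algebra_simps)
  qed
  have h_gt: "x < h x" if x: "0 < x" for x
  proof -
    have "x < x / (1 - exp (- x))" using x by (simp add: less_divide_eq)
    then have "p * x < p * (x / (1 - exp (- x)))" using p by (intro mult_strict_left_mono) auto
    then show ?thesis by (simp add: h_def algebra_simps)
  qed
  \<comment> \<open>With \<open>h x \<le> x + p\<close>, this choice gives
    \<open>h x0 \<le> (c + p) / 2 < c\<close>; at the right end \<open>h c > c\<close>.\<close>
  define x0 where "x0 = (c - p) / 2"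
  have x0: "0 < x0" "x0 < c" "h x0 \<le> c" using c p h_le[of x0] by (auto simp: x0_def field_simps)
  have "\<exists>x. x0 \<le> x \<and> x \<le> c \<and> h x = c"
  proof (rule IVT')
    show "continuous_on {x0..c} h" unfolding h_def using x0 by (intro continuous_intros) auto
  qed (use x0 h_gt[OF c(1)] in auto)
  then obtain x where x: "x0 \<le> x" "x \<le> c" "h x = c" by blast
  then have "0 < x" "x \<noteq> c" using x0 h_gt[OF c(1)] by auto
  then have x': "0 < x" "x < c" using x by auto
  show ?thesis
  proof (rule ex1I)
    show "is_beta p mu D (1 - x / c)" using x' x c by (simp add: beta_iff)
  next
    fix \<beta> assume "is_beta p mu D \<beta>"
    then have b: "0 < \<beta>" "\<beta> < 1" "h (c * (1 - \<beta>)) = c" by (auto simp: beta_iff)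
    then have "0 < c * (1 - \<beta>)" using c by simp
    then have "c * (1 - \<beta>) = x"
      using h_mono[of x "c * (1 - \<beta>)"] h_mono[of "c * (1 - \<beta>)" x] x' x b by (metis less_irrefl linorder_neqE)
    then show "\<beta> = 1 - x / c" using c by (simp add: field_simps)
  qed
qed

section \<open>Independence of functions of disjoint blocks of sources\<close>

text \<open>\<open>U\<close> and \<open>V\<close> have to agree with functions of their blocks only
  on \<open>space M\<close>, since the queue recursion holds only there. Laws and measurability do
  not see values elsewhere.\<close>

lemma (in prob_space) indep_var_of_restrictions:
  assumes ind: "indep_vars M' X I" and AB: "A \<inter> B = {}" "A \<subseteq> I" "B \<subseteq> I"
    and f: "f \<in> measurable (PiM A M') N1" and g: "g \<in> measurable (PiM B M') N2"
    and U: "\<And>\<omega>. \<omega> \<in> space M \<Longrightarrow> U \<omega> = f (\<lambda>s\<in>A. X s \<omega>)"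
    and V: "\<And>\<omega>. \<omega> \<in> space M \<Longrightarrow> V \<omega> = g (\<lambda>s\<in>B. X s \<omega>)"
  shows "indep_var N1 U N2 V"
proof -
  let ?f = "f \<circ> (\<lambda>\<omega>. \<lambda>s\<in>A. X s \<omega>)" and ?g = "g \<circ> (\<lambda>\<omega>. \<lambda>s\<in>B. X s \<omega>)"
  have "indep_var N1 ?f N2 ?g"
    by (rule indep_var_compose[OF indep_var_restrict[OF ind AB] f g])
  moreover have "distr M N1 ?f = distr M N1 U" "distr M N2 ?g = distr M N2 V"
      "distr M (N1 \<Otimes>\<^sub>M N2) (\<lambda>\<omega>. (?f \<omega>, ?g \<omega>)) = distr M (N1 \<Otimes>\<^sub>M N2) (\<lambda>\<omega>. (U \<omega>, V \<omega>))"
    by (auto intro!: distr_cong simp: U V)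
  moreover have "?f \<in> measurable M N1 \<longleftrightarrow> U \<in> measurable M N1" "?g \<in> measurable M N2 \<longleftrightarrow> V \<in> measurable M N2"
    by (auto intro!: measurable_cong simp: U V)
  ultimately show ?thesis unfolding indep_var_distribution_eq by simp
qed

section \<open>The geometric hop count\<close>

context polled_queue
begin

text \<open>The independent family contains \<open>k i\<close> only as a real-valued function; the
  floor recovers the integer.\<close>

lemma count_measurable:
  assumes i: "1 \<le> i"
  shows "k i \<in> measurable M (count_space UNIV)"
proof -
  have "drive Y k S T (Count i) \<in> borel_measurable M"
  proof -
    have "Count i \<in> sources" using i by (auto simp: sources_def)
    then show ?thesis using indep unfolding indep_vars_def by blast
  qed
  moreover have "(\<lambda>x::real. nat \<lfloor>x\<rfloor>) \<in> measurable borel (count_space UNIV)" by measurable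
  ultimately have "(\<lambda>\<omega>. nat \<lfloor>drive Y k S T (Count i) \<omega>\<rfloor>) \<in> measurable M (count_space UNIV)"
    by (rule measurable_compose)
  then show ?thesis by simp
qed

text \<open>The masses at \<open>n \<ge> 1\<close> are given and already sum to 1, so nothing is
  left for the value 0.\<close>

lemma count_distributed:
  assumes p: "0 < p" "p \<le> 1" and i: "1 \<le> i"
  shows "distributed M (count_space UNIV) (k i) (\<lambda>n. ennreal (if n = 0 then 0 else p * (1 - p) ^ (n - 1)))"
proof -
  note [measurable] = count_measurable[OF i]
  have sums1: "(\<lambda>n. prob {\<omega> \<in> space M. k i \<omega> = Suc n}) sums prob (\<Union>n. {\<omega> \<in> space M. k i \<omega> = Suc n})"
    by (rule finite_measure_UNION) (auto simp: disjoint_family_on_def)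
  have un: "(\<Union>n. {\<omega> \<in> space M. k i \<omega> = Suc n}) = {\<omega> \<in> space M. \<not> k i \<omega> = 0}"
    using not0_implies_Suc by auto
  have sums2: "(\<lambda>n. prob {\<omega> \<in> space M. k i \<omega> = Suc n}) sums 1"
    using sums_mult[OF geometric_sums[of "1 - p"], of p] p i by (simp add: count_geometric)
  have "prob {\<omega> \<in> space M. \<not> k i \<omega> = 0} = 1" by (rule sums_unique2[OF sums1[unfolded un] sums2])
  then have "prob {\<omega> \<in> space M. k i \<omega> = 0} = 0" by (subst (asm) prob_neg) auto
  then have pr: "prob {\<omega> \<in> space M. k i \<omega> = n} = (if n = 0 then 0 else p * (1 - p) ^ (n - 1))" for n
    using count_geometric[OF i, of n] by auto
  have "distr M (count_space UNIV) (k i) =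
      density (count_space UNIV) (\<lambda>n. ennreal (if n = 0 then 0 else p * (1 - p) ^ (n - 1)))"
  proof (rule measure_eqI_countable[where A=UNIV])
    fix n
    have "emeasure (distr M (count_space UNIV) (k i)) {n} = ennreal (prob {\<omega> \<in> space M. k i \<omega> = n})"
      by (simp add: emeasure_distr emeasure_eq_measure vimage_def Int_def conj_commute)
    then show "emeasure (distr M (count_space UNIV) (k i)) {n} =
        emeasure (density (count_space UNIV) (\<lambda>n. ennreal (if n = 0 then 0 else p * (1 - p) ^ (n - 1)))) {n}"
      unfolding pr by (simp add: emeasure_density nn_integral_indicator_singleton)
  qed auto
  then show ?thesis by (simp add: distributed_def count_measurable[OF i])
qed

text \<open>Reduces means of functions of the count to power series in \<open>1 - p\<close>.
  Nonnegativity of \<open>g\<close> makes convergence absolute, hence gives integrability. The index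
  is \<open>Suc m\<close> because the count starts at 1.\<close>

lemma count_has_expectation:
  assumes p: "0 < p" "p \<le> 1" and i: "1 \<le> i"
    and g: "\<And>n. 0 \<le> g n" and s: "(\<lambda>m. p * (1 - p) ^ m * g (Suc m)) sums s"
  shows "has_bochner_integral M (\<lambda>\<omega>. g (k i \<omega>)) s"
proof -
  let ?f = "\<lambda>n. if n = 0 then 0 else p * (1 - p) ^ (n - 1)"
  note D = count_distributed[OF p i]
  have f0: "0 \<le> ?f n" for n using p by simp
  have "(\<lambda>n. ?f n * g n) sums s"
    using s by (subst sums_Suc_iff[symmetric, where f="\<lambda>n. ?f n * g n", simplified]) simp
  then have "integrable (count_space UNIV) (\<lambda>n. ?f n * g n)" "(\<Sum>n. ?f n * g n) = s"
    using f0 g by (auto simp: integrable_count_space_nat_iff sums_iff abs_mult)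
  then show ?thesis
    using distributed_integral[OF D, of g] distributed_integrable[OF D, of g] f0
    by (simp add: has_bochner_integral_iff integral_count_space_nat)
qed

end

section \<open>Dependence structure of the D/M/1 queue\<close>

context dm1_polled_queue
begin

lemma interarrival_deterministic:
  assumes "1 \<le> i" "\<omega> \<in> space M"
  shows "interarrival Y k i \<omega> = real (k i \<omega>) / lam"
  using assms by (simp add: interarrival_def deterministic_hops)

lemma system_time_Suc:
  assumes "\<omega> \<in> space M"
  shows "T (Suc n) \<omega> = max 0 (T n \<omega> - real (k (Suc n) \<omega>) / lam) + S (Suc n) \<omega>"
  using assms by (simp add: system_time waiting_time_def interarrival_deterministic)

text \<open>The sources that determine \<open>T n\<close>; hops are absent because their durations
  are constant.\<close>

definition past :: "nat \<Rightarrow> source set" where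
  "past n = insert Initial (Count ` {1..n} \<union> Service ` {1..n})"

lemma past_subset_sources: "past n \<subseteq> sources"
  by (auto simp: past_def sources_def)

text \<open>Induction along the queue recursion, starting from \<open>T 0\<close>, which is a source
  itself.\<close>

lemma system_time_function_of_past:
  "\<exists>f \<in> borel_measurable (PiM (past n) (\<lambda>_. borel)).
    \<forall>\<omega>\<in>space M. T n \<omega> = f (\<lambda>s\<in>past n. drive Y k S T s \<omega>)"
proof (induction n)
  case 0
  show ?case
    by (rule bexI[where x="\<lambda>x. x Initial"]) (auto simp: past_def)
next
  case (Suc n)
  then obtain f where f[measurable]: "f \<in> borel_measurable (PiM (past n) (\<lambda>_. borel))"
    and T: "\<And>\<omega>. \<omega> \<in> space M \<Longrightarrow> T n \<omega> = f (\<lambda>s\<in>past n. drive Y k S T s \<omega>)" by blast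
  \<comment> \<open>One step of the recursion, read off the source coordinates.\<close>
  let ?g = "\<lambda>x. max 0 (f (restrict x (past n)) - x (Count (Suc n)) / lam) + x (Service (Suc n))"
  have sub: "past n \<subseteq> past (Suc n)" by (auto simp: past_def)
  then have [measurable]: "(\<lambda>x. restrict x (past n)) \<in> measurable (PiM (past (Suc n)) (\<lambda>_. borel)) (PiM (past n) (\<lambda>_. borel))"
    by (rule measurable_restrict_subset)
  have mem: "Count (Suc n) \<in> past (Suc n)" "Service (Suc n) \<in> past (Suc n)" by (auto simp: past_def)
  have [measurable]: "(\<lambda>x. x (Count (Suc n))) \<in> borel_measurable (PiM (past (Suc n)) (\<lambda>_. borel :: real measure))"
    "(\<lambda>x. x (Service (Suc n))) \<in> borel_measurable (PiM (past (Suc n)) (\<lambda>_. borel :: real measure))"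
    using mem by (auto intro: measurable_component_singleton)
  have T_Suc: "T (Suc n) \<omega> = ?g (\<lambda>s\<in>past (Suc n). drive Y k S T s \<omega>)" if \<omega>: "\<omega> \<in> space M" for \<omega>
  proof -
    have "restrict (\<lambda>s\<in>past (Suc n). drive Y k S T s \<omega>) (past n) = (\<lambda>s\<in>past n. drive Y k S T s \<omega>)"
      using sub by (auto simp: restrict_def fun_eq_iff)
    then show ?thesis by (simp only: system_time_Suc[OF \<omega>] T[OF \<omega>] restrict_apply mem if_True drive.simps)
  qed
  show ?case
  proof (rule bexI, rule ballI)
    show "?g \<in> borel_measurable (PiM (past (Suc n)) (\<lambda>_. borel))" by measurable
  qed (rule T_Suc)
qed

text \<open>\<open>T n\<close> involves counts up to \<open>n\<close> only, so the next count is a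
  fresh source.\<close>

lemma indep_system_time_count:
  "indep_var borel (T n) borel (\<lambda>\<omega>. real (k (Suc n) \<omega>))"
proof -
  obtain f where f: "f \<in> borel_measurable (PiM (past n) (\<lambda>_. borel))"
    and T: "\<And>\<omega>. \<omega> \<in> space M \<Longrightarrow> T n \<omega> = f (\<lambda>s\<in>past n. drive Y k S T s \<omega>)"
    using system_time_function_of_past by blast
  show ?thesis
    by (rule indep_var_of_restrictions[OF indep _ past_subset_sources _ f, where B="{Count (Suc n)}" and g="\<lambda>x. x (Count (Suc n))"])
      (auto simp: T past_def sources_def)
qed

text \<open>The waiting time adds the next count to the past of \<open>T n\<close>, but not yet the
  next service time.\<close>

lemma indep_waiting_time_service:
  "indep_var borel (\<lambda>\<omega>. max 0 (T n \<omega> - real (k (Suc n) \<omega>) / lam)) borel (S (Suc n))"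
proof -
  obtain f where f[measurable]: "f \<in> borel_measurable (PiM (past n) (\<lambda>_. borel))"
    and T: "\<And>\<omega>. \<omega> \<in> space M \<Longrightarrow> T n \<omega> = f (\<lambda>s\<in>past n. drive Y k S T s \<omega>)"
    using system_time_function_of_past by blast
  let ?A = "insert (Count (Suc n)) (past n)"
  let ?g = "\<lambda>x. max 0 (f (restrict x (past n)) - x (Count (Suc n)) / lam)"
  have [measurable]: "(\<lambda>x. restrict x (past n)) \<in> measurable (PiM ?A (\<lambda>_. borel)) (PiM (past n) (\<lambda>_. borel))"
    by (rule measurable_restrict_subset) auto
  have [measurable]: "(\<lambda>x. x (Count (Suc n))) \<in> borel_measurable (PiM ?A (\<lambda>_. borel :: real measure))"
    by (rule measurable_component_singleton) simp
  have W: "max 0 (T n \<omega> - real (k (Suc n) \<omega>) / lam) = ?g (\<lambda>s\<in>?A. drive Y k S T s \<omega>)"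
    if \<omega>: "\<omega> \<in> space M" for \<omega>
  proof -
    have "restrict (\<lambda>s\<in>?A. drive Y k S T s \<omega>) (past n) = (\<lambda>s\<in>past n. drive Y k S T s \<omega>)"
      by (auto simp: restrict_def fun_eq_iff)
    then show ?thesis by (simp only: T[OF \<omega>] restrict_apply insertI1 if_True drive.simps)
  qed
  have "?g \<in> borel_measurable (PiM ?A (\<lambda>_. borel))"
    by measurable
  moreover have "?A \<subseteq> sources" "{Service (Suc n)} \<subseteq> sources"
    using past_subset_sources[of n] by (auto simp: sources_def)
  moreover have "?A \<inter> {Service (Suc n)} = {}" by (auto simp: past_def)
  ultimately show ?thesis
    using W
    by (intro indep_var_of_restrictions[OF indep, where A="?A" and B="{Service (Suc n)}"
          and f="?g" and g="\<lambda>x. x (Service (Suc n))"]) (assumption | simp)+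
qed

lemma indep_count_service:
  assumes "1 \<le> i"
  shows "indep_var borel (\<lambda>\<omega>. real (k i \<omega>)) borel (S i)"
  by (rule indep_var_of_restrictions[OF indep, where A="{Count i}" and B="{Service i}"
        and f="\<lambda>x. x (Count i)" and g="\<lambda>x. x (Service i)"])
    (use assms in \<open>auto simp: sources_def\<close>)

section \<open>Exponential system time and the mean of the waiting term\<close>

text \<open>The equation for \<beta> is the transform condition at rate
  \<open>mu * (1 - \<beta>)\<close>: the generating function of the count at \<open>z\<close> is
  \<open>p * z / (1 - (1 - p) * z)\<close>.\<close>

lemma system_time_exponential:
  assumes p: "0 < p" "p \<le> 1" and lam: "0 < lam" and mu: "0 < mu"
    and \<beta>: "is_beta p mu (1 / lam) \<beta>"
  shows "distributed M lborel (T n) (exponential_density (mu * (1 - \<beta>)))"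
proof (rule gm1_system_time_exponential)
  define z where "z = exp (- mu * (1 - \<beta>) * (1 / lam))"
  have b: "0 < \<beta>" "\<beta> < 1" and \<beta>_eq: "\<beta> = p * z / (1 - (1 - p) * z)"
    using \<beta> by (auto simp: is_beta_def z_def)
  let ?X = "\<lambda>\<omega>. real (k (Suc n) \<omega>) / lam"
  show "0 < mu * (1 - \<beta>)" "mu * (1 - \<beta>) < mu" using b mu by auto
  have z: "0 < z" "z < 1" using b mu lam by (auto simp: z_def)
  have "\<bar>(1 - p) * z\<bar> < 1" using p z by (smt (verit) mult_left_le_one_le mult_nonneg_nonneg)
  then have "(\<lambda>m. (p * z) * ((1 - p) * z) ^ m) sums ((p * z) * (1 / (1 - (1 - p) * z)))"
    by (intro sums_mult geometric_sums) simp
  then have "(\<lambda>m. p * (1 - p) ^ m * z ^ Suc m) sums \<beta>"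
    using \<beta>_eq by (simp add: power_mult_distrib mult_ac)
  then have "has_bochner_integral M (\<lambda>\<omega>. z ^ k (Suc n) \<omega>) \<beta>"
    using z by (intro count_has_expectation[OF p]) auto
  moreover have "z ^ j = exp (- (mu * (1 - \<beta>)) * (real j / lam))" for j
    by (simp add: z_def exp_of_nat_mult[symmetric])
  ultimately show "expectation (\<lambda>\<omega>. exp (- (mu * (1 - \<beta>)) * ?X \<omega>)) = 1 - mu * (1 - \<beta>) / mu"
    using mu by (simp add: has_bochner_integral_iff)
  show "indep_var borel (T n) borel ?X"
    using indep_var_compose[OF indep_system_time_count[of n], of "\<lambda>x. x" borel "\<lambda>x. x / lam" borel]
    by (simp add: comp_def)
  show "indep_var borel (\<lambda>\<omega>. max 0 (T n \<omega> - ?X \<omega>)) borel (S (Suc n))"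
    by (rule indep_waiting_time_service)
  show "distributed M lborel (S (Suc n)) (exponential_density mu)" by (rule exponential_service) simp
  \<comment> \<open>One recursion step leads from \<open>T n\<close> to \<open>T (Suc n)\<close>,
    and both have the law of \<open>T 0\<close>.\<close>
  have "distr M borel (\<lambda>\<omega>. max 0 (T n \<omega> - ?X \<omega>) + S (Suc n) \<omega>) = distr M borel (T (Suc n))"
    by (rule distr_cong) (auto simp: system_time_Suc)
  then show "distr M borel (\<lambda>\<omega>. max 0 (T n \<omega> - ?X \<omega>) + S (Suc n) \<omega>) = distr M borel (T n)"
    using steady_state[of n] steady_state[of "Suc n"] by simp
  show "0 \<le> ?X \<omega>" for \<omega> using lam by simp
qed

text \<open>The waiting time depends on the count, so the mean does not factor. Freezing the count
  leaves the mean excess of an exponential variable, and averaging over the count gives a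
  differentiated geometric series. Nonnegative integrals yield integrability along the way.\<close>

lemma count_waiting_time_expectation:
  assumes p: "0 < p" "p \<le> 1" and lam: "0 < lam" and mu: "0 < mu"
    and \<beta>: "is_beta p mu (1 / lam) \<beta>"
  shows "has_bochner_integral M
      (\<lambda>\<omega>. real (k (Suc n) \<omega>) * max 0 (T n \<omega> - real (k (Suc n) \<omega>) / lam))
      (p * exp (- mu * (1 - \<beta>) * (1 / lam)) /
        (mu * (1 - \<beta>) * (1 - (1 - p) * exp (- mu * (1 - \<beta>) * (1 / lam)))\<^sup>2))"
proof -
  define th where "th = mu * (1 - \<beta>)"
  define z where "z = exp (- mu * (1 - \<beta>) * (1 / lam))"
  let ?K = "\<lambda>\<omega>. real (k (Suc n) \<omega>)"
  have b: "0 < \<beta>" "\<beta> < 1" using \<beta> by (auto simp: is_beta_def)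
  have th: "0 < th" using b mu by (simp add: th_def)
  have z: "0 < z" "z < 1" using b mu lam by (auto simp: z_def)
  have x: "\<bar>(1 - p) * z\<bar> < 1" using p z by (smt (verit) mult_left_le_one_le mult_nonneg_nonneg)
  have z_pow: "z ^ j = exp (- th * (real j / lam))" for j
    by (simp add: z_def th_def exp_of_nat_mult[symmetric])
  have [measurable]: "T n \<in> borel_measurable M" "?K \<in> borel_measurable M"
    using indep_var_rv1[OF indep_system_time_count[of n]] indep_var_rv2[OF indep_system_time_count[of n]] by simp_all
  define s where "s = p * z / (th * (1 - (1 - p) * z)\<^sup>2)"
  have "(\<lambda>m. (p * z / th) * (real (Suc m) * ((1 - p) * z) ^ m)) sums ((p * z / th) * (1 / (1 - (1 - p) * z)\<^sup>2))"
    using x by (intro sums_mult geometric_deriv_sums) simp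
  also have "(p * z / th) * (1 / (1 - (1 - p) * z)\<^sup>2) = s" by (simp add: s_def)
  also have "(\<lambda>m. (p * z / th) * (real (Suc m) * ((1 - p) * z) ^ m)) =
      (\<lambda>m. p * (1 - p) ^ m * (real (Suc m) * (z ^ Suc m / th)))"
    by (simp add: power_mult_distrib mult_ac)
  finally have K: "has_bochner_integral M (\<lambda>\<omega>. ?K \<omega> * (z ^ k (Suc n) \<omega> / th)) s"
    using z th by (intro count_has_expectation[OF p]) auto
  have s: "0 \<le> s" using p z th by (auto simp: s_def)
  have "(\<integral>\<^sup>+\<omega>. ennreal (?K \<omega> * max 0 (T n \<omega> - ?K \<omega> / lam)) \<partial>M) =
      (\<integral>\<^sup>+\<omega>'. (\<integral>\<^sup>+\<omega>. ennreal (?K \<omega>' * max 0 (T n \<omega> - ?K \<omega>' / lam)) \<partial>M) \<partial>M)"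
    using indep_var_nn_integral_pair[OF indep_system_time_count[of n],
        of "\<lambda>(t, x). ennreal (x * max 0 (t - x / lam))"] by simp
  also have "\<dots> = (\<integral>\<^sup>+\<omega>'. ennreal (?K \<omega>' * (z ^ k (Suc n) \<omega>' / th)) \<partial>M)"
  proof (rule nn_integral_cong)
    fix \<omega>'
    have "(\<integral>\<^sup>+\<omega>. ennreal (max 0 (T n \<omega> - ?K \<omega>' / lam)) \<partial>M) = ennreal (z ^ k (Suc n) \<omega>' / th)"
      unfolding z_pow
      by (rule exponential_distributed_nn_integral_excess)
        (use system_time_exponential[OF p lam mu \<beta>] th lam in \<open>auto simp: th_def\<close>)
    moreover have "(\<integral>\<^sup>+\<omega>. ennreal (?K \<omega>' * max 0 (T n \<omega> - ?K \<omega>' / lam)) \<partial>M) =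
        ennreal (?K \<omega>') * (\<integral>\<^sup>+\<omega>. ennreal (max 0 (T n \<omega> - ?K \<omega>' / lam)) \<partial>M)"
      by (subst nn_integral_cmult[symmetric], measurable) (intro nn_integral_cong ennreal_mult, auto)
    moreover have "ennreal (?K \<omega>' * (z ^ k (Suc n) \<omega>' / th)) = ennreal (?K \<omega>') * ennreal (z ^ k (Suc n) \<omega>' / th)"
      using z th by (intro ennreal_mult) auto
    ultimately show "(\<integral>\<^sup>+\<omega>. ennreal (?K \<omega>' * max 0 (T n \<omega> - ?K \<omega>' / lam)) \<partial>M) =
        ennreal (?K \<omega>' * (z ^ k (Suc n) \<omega>' / th))"
      by simp
  qed
  also have "\<dots> = ennreal s"
    using K z th by (subst nn_integral_eq_integral) (auto simp: has_bochner_integral_iff)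
  finally have "has_bochner_integral M (\<lambda>\<omega>. ?K \<omega> * max 0 (T n \<omega> - ?K \<omega> / lam)) s"
    using s by (intro has_bochner_integral_nn_integral) auto
  then show ?thesis by (simp only: s_def th_def z_def)
qed

section \<open>Expectation of \<open>Q\<close>\<close>

text \<open>Constant hops turn all sums into polynomials in the count. Splitting the system time
  into waiting and service separates the dependent factor from the independent one.\<close>

lemma Q_deterministic:
  assumes "\<omega> \<in> space M"
  shows "Q v Y k T (Suc n) \<omega> =
    v\<^sup>2 * (1 / lam) ^ 3 / 3 * real (k (Suc n) \<omega>) +
    v\<^sup>2 * (1 / lam) ^ 3 * (real (k (Suc n) \<omega> * (k (Suc n) \<omega> - 1)) / 2) +
    v\<^sup>2 * (1 / lam)\<^sup>2 *
      (real (k (Suc n) \<omega>) * max 0 (T n \<omega> - real (k (Suc n) \<omega>) / lam) + real (k (Suc n) \<omega>) * S (Suc n) \<omega>)"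
proof -
  define D where "D = 1 / lam"
  have Y: "Y (Suc n) j \<omega> = D" if "1 \<le> j" for j using assms that by (simp add: deterministic_hops D_def)
  \<comment> \<open>\<open>j - 1\<close> counts the earlier hops of the cycle. Truncated subtraction
    is harmless: \<open>j \<ge> 1\<close>, and for \<open>m = 0\<close> the product is 0.\<close>
  have sum_pred: "(\<Sum>j=1..m. real (j - 1)) = real (m * (m - 1)) / 2" for m
  proof (induction m)
    case (Suc m)
    then show ?case by (cases m) (auto simp: field_simps)
  qed simp
  have G1: "G1 v Y k (Suc n) \<omega> = v\<^sup>2 * D ^ 3 / 3 * real (k (Suc n) \<omega>)"
    by (simp add: G1_def Y)
  have H: "H v Y k (Suc n) \<omega> = v\<^sup>2 * D\<^sup>2 * real (k (Suc n) \<omega>)"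
    by (simp add: H_def Y)
  have G2: "G2 v Y k (Suc n) \<omega> = v\<^sup>2 * D ^ 3 * (real (k (Suc n) \<omega> * (k (Suc n) \<omega> - 1)) / 2)"
  proof -
    have "G2 v Y k (Suc n) \<omega> = (\<Sum>j=1..k (Suc n) \<omega>. v\<^sup>2 * D ^ 3 * real (j - 1))"
      unfolding G2_def by (intro sum.cong) (auto simp: Y power2_eq_square power3_eq_cube)
    then show ?thesis by (simp only: sum_distrib_left[symmetric] sum_pred)
  qed
  show ?thesis
    unfolding Q_def G3_def system_time_Suc[OF assms] D_def[symmetric] G1 G2 H
    by (simp only: distrib_left mult.assoc)
qed

lemma Q_expectation:
  assumes p: "0 < p" "p \<le> 1" and lam: "0 < lam" and mu: "0 < mu"
    and \<beta>: "is_beta p mu D \<beta>" and i: "1 \<le> i" and D: "D = 1 / lam"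
  shows "has_bochner_integral M (Q v Y k T i)
    (v\<^sup>2 * D ^ 3 / (3 * p) + v\<^sup>2 * D ^ 3 * (1 - p) / p\<^sup>2 +
        v\<^sup>2 * D\<^sup>2 *
          (p * exp (- mu * (1 - \<beta>) * D) /
             (mu * (1 - \<beta>) * (1 - (1 - p) * exp (- mu * (1 - \<beta>) * D))\<^sup>2)
           + 1 / (mu * p)))"
proof -
  obtain n where n: "i = Suc n" using i by (cases i) auto
  let ?K = "\<lambda>\<omega>. real (k (Suc n) \<omega>)"
  have q: "norm (1 - p) < 1" using p by simp
  have "(\<lambda>m. p * (real (Suc m) * (1 - p) ^ m)) sums (p * (1 / (1 - (1 - p))\<^sup>2))"
    by (intro sums_mult geometric_deriv_sums q)
  then have K: "has_bochner_integral M ?K (1 / p)"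
    using p by (intro count_has_expectation[OF p]) (auto simp: power2_eq_square mult_ac)
  have "(\<lambda>m. p * (real (Suc m * m) / 2 * (1 - p) ^ m)) sums (p * ((1 - p) / (1 - (1 - p)) ^ 3))"
    by (intro sums_mult triangular_power_sums q)
  then have KK: "has_bochner_integral M (\<lambda>\<omega>. real (k (Suc n) \<omega> * (k (Suc n) \<omega> - 1)) / 2) ((1 - p) / p\<^sup>2)"
    using p by (intro count_has_expectation[OF p]) (auto simp: power2_eq_square power3_eq_cube mult_ac)
  have S: "has_bochner_integral M (S (Suc n)) (1 / mu)"
  proof -
    note dS = exponential_service[of "Suc n"]
    have [measurable]: "S (Suc n) \<in> borel_measurable M" using distributed_measurable[OF dS] by simp
    have "expectation (S (Suc n)) = 1 / mu"
      by (rule exponential_distributed_expectation[OF mu dS]) simp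
    moreover have "integrable M (S (Suc n))"
      \<comment> \<open>The integral of a non-integrable function is 0 by convention, so the nonzero
        value \<open>1 / mu\<close> proves integrability.\<close>
      using calculation mu not_integrable_integral_eq[of M "S (Suc n)"] by (cases "integrable M (S (Suc n))") auto
    ultimately show ?thesis by (simp add: has_bochner_integral_iff)
  qed
  \<comment> \<open>Unlike the waiting time, the service time is independent of the count, so this
    mean factors.\<close>
  have KS: "has_bochner_integral M (\<lambda>\<omega>. ?K \<omega> * S (Suc n) \<omega>) (1 / p * (1 / mu))"
    using indep_var_integrable[OF indep_count_service[of "Suc n"]]
      indep_var_lebesgue_integral[OF indep_count_service[of "Suc n"]] K S
    by (simp add: has_bochner_integral_iff)
  note KW = count_waiting_time_expectation[OF p lam mu \<beta>[unfolded D], of n]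
  have "has_bochner_integral M (\<lambda>\<omega>. v\<^sup>2 * (1 / lam) ^ 3 / 3 * ?K \<omega> +
      v\<^sup>2 * (1 / lam) ^ 3 * (real (k (Suc n) \<omega> * (k (Suc n) \<omega> - 1)) / 2) +
      v\<^sup>2 * (1 / lam)\<^sup>2 * (?K \<omega> * max 0 (T n \<omega> - ?K \<omega> / lam) + ?K \<omega> * S (Suc n) \<omega>))
    (v\<^sup>2 * (1 / lam) ^ 3 / 3 * (1 / p) + v\<^sup>2 * (1 / lam) ^ 3 * ((1 - p) / p\<^sup>2) +
      v\<^sup>2 * (1 / lam)\<^sup>2 * (p * exp (- mu * (1 - \<beta>) * (1 / lam)) /
        (mu * (1 - \<beta>) * (1 - (1 - p) * exp (- mu * (1 - \<beta>) * (1 / lam)))\<^sup>2) + 1 / p * (1 / mu)))"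
    by (intro has_bochner_integral_add has_bochner_integral_mult_right K KK KS KW)
  also have "?this \<longleftrightarrow> has_bochner_integral M (Q v Y k T (Suc n)) (v\<^sup>2 * (1 / lam) ^ 3 / 3 * (1 / p) + v\<^sup>2 * (1 / lam) ^ 3 * ((1 - p) / p\<^sup>2) +
      v\<^sup>2 * (1 / lam)\<^sup>2 * (p * exp (- mu * (1 - \<beta>) * (1 / lam)) /
        (mu * (1 - \<beta>) * (1 - (1 - p) * exp (- mu * (1 - \<beta>) * (1 / lam)))\<^sup>2) + 1 / p * (1 / mu)))"
    by (intro has_bochner_integral_cong) (simp_all only: Q_deterministic)
  finally show ?thesis unfolding n D by (simp add: mult_ac)
qed

end

section \<open>Age of Positioning under the stability condition\<close>

theorem theorem3:
  fixes M :: "'a measure"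
    and v lam mu p D rho :: real
    and m :: mode
    and Y :: "nat \<Rightarrow> nat \<Rightarrow> 'a \<Rightarrow> real"
    and k :: "nat \<Rightarrow> 'a \<Rightarrow> nat"
    and S T :: "nat \<Rightarrow> 'a \<Rightarrow> real"
    and i :: nat
  assumes "v > 0" and "lam > 0" and "mu > 0" and "0 < p" and "p \<le> 1"
    and "D = 1 / lam"
    and "rho = p * lam / mu" and "rho < 1"
    and "dm1_polled_queue M p Y k S T lam mu"
    and "1 \<le> i"
  shows "(\<exists>!\<beta>. is_beta p mu D \<beta>) \<and>
    (\<forall>\<beta>. is_beta p mu D \<beta> \<longrightarrow>
      integrable M (Q v Y k T i) \<and>
      AoP M p lam m v Y k T i = p * kappa m * lam * (\<integral>\<omega>. Q v Y k T i \<omega> \<partial>M) \<and>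
      (\<integral>\<omega>. Q v Y k T i \<omega> \<partial>M) =
        v\<^sup>2 * D ^ 3 / (3 * p) + v\<^sup>2 * D ^ 3 * (1 - p) / p\<^sup>2 +
        v\<^sup>2 * D\<^sup>2 *
          (p * exp (- mu * (1 - \<beta>) * D) /
             (mu * (1 - \<beta>) * (1 - (1 - p) * exp (- mu * (1 - \<beta>) * D))\<^sup>2)
           + 1 / (mu * p)))"
proof (intro conjI allI impI)
  interpret dm1_polled_queue M p Y k S T lam mu by fact
  \<comment> \<open>\<open>rho < 1\<close> is turned into \<open>p < mu * D\<close>, the form in
    which stability ensures a root \<beta>.\<close>
  have "p * lam < mu" using assms(3,7,8) by (simp add: divide_less_eq)
  then have "p < mu * D" using assms(2,6) by (simp add: less_divide_eq)
  then show "\<exists>!\<beta>. is_beta p mu D \<beta>"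
    using assms by (intro ex1_is_beta) auto
  fix \<beta> assume "is_beta p mu D \<beta>"
  note Q = Q_expectation[OF \<open>0 < p\<close> \<open>p \<le> 1\<close> \<open>lam > 0\<close> \<open>mu > 0\<close> this \<open>1 \<le> i\<close> \<open>D = 1 / lam\<close>, of v]
  show "integrable M (Q v Y k T i)" using Q by (simp add: has_bochner_integral_iff)
  show "(\<integral>\<omega>. Q v Y k T i \<omega> \<partial>M) = v\<^sup>2 * D ^ 3 / (3 * p) + v\<^sup>2 * D ^ 3 * (1 - p) / p\<^sup>2 +
        v\<^sup>2 * D\<^sup>2 *
          (p * exp (- mu * (1 - \<beta>) * D) /
             (mu * (1 - \<beta>) * (1 - (1 - p) * exp (- mu * (1 - \<beta>) * D))\<^sup>2)
           + 1 / (mu * p))"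
    using Q by (rule has_bochner_integral_integral_eq)
qed (simp add: AoP_def)

end
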